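(* The functor $\Gamma:\mathbf{AR}\to\mathbf{AG}_\bullet^I$, which sends an Archimedean ring $R$ to its underlying Archimedean group pointed by the multiplicative identity, $\Gamma(R)=(R,1)$ (and sends a ring homomorphism to its underlying group homomorphism), is part of an adjoint equivalence between $\mathbf{AR}$ and $\mathbf{AG}_\bullet^I$.
   Context: A totally ordered group is a group $G$ (written additively, not assumed commutative) with a total order $<$ such that $x<y$ implies $x+z<y+z$ and $z+x<z+y$. $\mathbb{N}=\{1,2,3,\dots\}$. $G$ is Archimedean if for all $x,y>0$ there is $n\in\mathbb{N}$ with $x<ny$, and for all $x,y<0$ there is $n\in\mathbb{N}$ with $x>ny$. A morphism of Archimedean groups is a group homomorphism that is either positive ($x<y\Rightarrow f(x)<f(y)$) or negative ($x<y\Rightarrow f(x)>f(y)$). $\mathbf{AG}_\bullet$ is the category of pairs $(A,a)$ with $A$ an Archimedean group and $a\in A$, $a\ne0$; arrows $(A,a)\to(B,b)$ are morphisms $f:A\to B$ with $f(a)=b$. An initial element of an Archimedean group $A$ is a nonzero $i\in A$ such that for every nonzero $a\in A$ there is an arrow $(A,i)\to(A,a)$. $\mathbf{AG}_\bullet^I$ is the full subcategory of $\mathbf{AG}_\bullet$ of those $(A,i)$ for which $i$ is an initial element of $A$. An Archimedean ring is an (associative, unital, not assumed commutative) ring whose additive group carries a total order making it an Archimedean group, such that $1\neq 0$ and $a,b>0$ implies $ab>0$. $\mathbf{AR}$ is the category of Archimedean rings, with arrows the ring homomorphisms preserving $1$ whose underlying map is a morphism of Archimedean groups. The identity $1$ of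 an Archimedean ring is an initial element of its underlying Archimedean group, so $\Gamma$ is well defined. *)

theory Defs
  imports "HOL-Algebra.Ring"
begin

section \<open>Archimedean groups and rings\<close>

text \<open>
  Groups are written multiplicatively, as in \<open>HOL-Algebra\<close>: the additive notation
  \<open>x + y\<close>, \<open>0\<close>, \<open>n y\<close> becomes \<open>x \<otimes> y\<close>, \<open>\<one>\<close>, \<open>y [^] n\<close>. The strict order \<open><\<close> is a
  relation \<open>r\<close> on the carrier, with \<open>x < y\<close> written \<open>(x, y) \<in> r\<close>.
\<close>

locale totally_ordered_group = group G for G :: "('a, 'm) monoid_scheme" (structure) +
  fixes r :: "('a \<times> 'a) set"
  assumes less_carrier: "r \<subseteq> carrier G \<times> carrier G"
    and less_linear: "strict_linear_order_on (carrier G) r"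
    and less_translate_right:
      "\<lbrakk>(x, y) \<in> r; z \<in> carrier G\<rbrakk> \<Longrightarrow> (x \<otimes> z, y \<otimes> z) \<in> r"
    and less_translate_left:
      "\<lbrakk>(x, y) \<in> r; z \<in> carrier G\<rbrakk> \<Longrightarrow> (z \<otimes> x, z \<otimes> y) \<in> r"

locale archimedean_group = totally_ordered_group +
  assumes archimedean_pos:
      "\<lbrakk>(\<one>, x) \<in> r; (\<one>, y) \<in> r\<rbrakk> \<Longrightarrow> \<exists>n::nat. n \<ge> 1 \<and> (x, y [^] n) \<in> r"
    and archimedean_neg:
      "\<lbrakk>(x, \<one>) \<in> r; (y, \<one>) \<in> r\<rbrakk> \<Longrightarrow> \<exists>n::nat. n \<ge> 1 \<and> (y [^] n, x) \<in> r"

type_synonym 'a ordered_grp = "'a monoid \<times> ('a \<times> 'a) set"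

definition positive_map :: "('a \<times> 'a) set \<Rightarrow> ('b \<times> 'b) set \<Rightarrow> ('a \<Rightarrow> 'b) \<Rightarrow> bool" where
  "positive_map r s f \<longleftrightarrow> (\<forall>x y. (x, y) \<in> r \<longrightarrow> (f x, f y) \<in> s)"

definition negative_map :: "('a \<times> 'a) set \<Rightarrow> ('b \<times> 'b) set \<Rightarrow> ('a \<Rightarrow> 'b) \<Rightarrow> bool" where
  "negative_map r s f \<longleftrightarrow> (\<forall>x y. (x, y) \<in> r \<longrightarrow> (f y, f x) \<in> s)"

text \<open>
  Morphisms are required to be \<^const>\<open>extensional\<close>, so that two of them are equal as HOL
  functions exactly when they agree on the carrier of their domain.
\<close>

definition arch_hom :: "'a ordered_grp \<Rightarrow> 'b ordered_grp \<Rightarrow> ('a \<Rightarrow> 'b) set" where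
  "arch_hom A B =
    {f \<in> hom (fst A) (fst B) \<inter> extensional (carrier (fst A)).
      positive_map (snd A) (snd B) f \<or> negative_map (snd A) (snd B) f}"

locale archimedean_ring = ring R for R :: "('a, 'm) ring_scheme" (structure) +
  fixes r :: "('a \<times> 'a) set"
  assumes additive_archimedean: "archimedean_group (add_monoid R) r"
    and one_neq_zero: "\<one> \<noteq> \<zero>"
    and mult_pos: "\<lbrakk>(\<zero>, a) \<in> r; (\<zero>, b) \<in> r\<rbrakk> \<Longrightarrow> (\<zero>, a \<otimes> b) \<in> r"

type_synonym 'a ordered_rng = "'a ring \<times> ('a \<times> 'a) set"

definition underlying_group :: "'a ordered_rng \<Rightarrow> 'a ordered_grp" where
  "underlying_group R = (add_monoid (fst R), snd R)"


section \<open>Categories, functors and adjoint equivalences\<close>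

text \<open>
  Hom-sets are indexed by domain and codomain and need not be disjoint, so every operation on
  arrows takes the relevant objects as arguments. \<open>Comp C X Y Z g f\<close> is the composite of
  \<open>f : X \<rightarrow> Y\<close> followed by \<open>g : Y \<rightarrow> Z\<close>.
\<close>

record ('o, 'm) cat =
  Ob :: "'o set"
  Hom :: "'o \<Rightarrow> 'o \<Rightarrow> 'm set"
  Ident :: "'o \<Rightarrow> 'm"
  Comp :: "'o \<Rightarrow> 'o \<Rightarrow> 'o \<Rightarrow> 'm \<Rightarrow> 'm \<Rightarrow> 'm"

locale category =
  fixes C :: "('o, 'm) cat"
  assumes ident_hom: "X \<in> Ob C \<Longrightarrow> Ident C X \<in> Hom C X X"
    and comp_hom:
      "\<lbrakk>X \<in> Ob C; Y \<in> Ob C; Z \<in> Ob C; f \<in> Hom C X Y; g \<in> Hom C Y Z\<rbrakk>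
        \<Longrightarrow> Comp C X Y Z g f \<in> Hom C X Z"
    and comp_ident_right:
      "\<lbrakk>X \<in> Ob C; Y \<in> Ob C; f \<in> Hom C X Y\<rbrakk> \<Longrightarrow> Comp C X X Y f (Ident C X) = f"
    and comp_ident_left:
      "\<lbrakk>X \<in> Ob C; Y \<in> Ob C; f \<in> Hom C X Y\<rbrakk> \<Longrightarrow> Comp C X Y Y (Ident C Y) f = f"
    and comp_assoc:
      "\<lbrakk>W \<in> Ob C; X \<in> Ob C; Y \<in> Ob C; Z \<in> Ob C;
        f \<in> Hom C W X; g \<in> Hom C X Y; h \<in> Hom C Y Z\<rbrakk>
        \<Longrightarrow> Comp C W X Z (Comp C X Y Z h g) f = Comp C W Y Z h (Comp C W X Y g f)"

definition full_subcategory :: "('o, 'm) cat \<Rightarrow> ('o \<Rightarrow> bool) \<Rightarrow> ('o, 'm) cat" where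
  "full_subcategory C P = C\<lparr>Ob := {X \<in> Ob C. P X}\<rparr>"

definition isomorphism :: "('o, 'm) cat \<Rightarrow> 'o \<Rightarrow> 'o \<Rightarrow> 'm \<Rightarrow> bool" where
  "isomorphism C X Y f \<longleftrightarrow> f \<in> Hom C X Y \<and>
    (\<exists>g \<in> Hom C Y X. Comp C X Y X g f = Ident C X \<and> Comp C Y X Y f g = Ident C Y)"

record ('o, 'm, 'p, 'n) fnctr =
  FOb :: "'o \<Rightarrow> 'p"
  FArr :: "'o \<Rightarrow> 'o \<Rightarrow> 'm \<Rightarrow> 'n"

locale is_functor = dom: category C + cod: category D
  for C :: "('o, 'm) cat" and D :: "('p, 'n) cat" +
  fixes F :: "('o, 'm, 'p, 'n) fnctr"
  assumes functor_ob: "X \<in> Ob C \<Longrightarrow> FOb F X \<in> Ob D"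
    and functor_hom:
      "\<lbrakk>X \<in> Ob C; Y \<in> Ob C; f \<in> Hom C X Y\<rbrakk> \<Longrightarrow> FArr F X Y f \<in> Hom D (FOb F X) (FOb F Y)"
    and functor_ident: "X \<in> Ob C \<Longrightarrow> FArr F X X (Ident C X) = Ident D (FOb F X)"
    and functor_comp:
      "\<lbrakk>X \<in> Ob C; Y \<in> Ob C; Z \<in> Ob C; f \<in> Hom C X Y; g \<in> Hom C Y Z\<rbrakk>
        \<Longrightarrow> FArr F X Z (Comp C X Y Z g f) =
            Comp D (FOb F X) (FOb F Y) (FOb F Z) (FArr F Y Z g) (FArr F X Y f)"

definition id_fnctr :: "('o, 'm, 'o, 'm) fnctr" where
  "id_fnctr = \<lparr>FOb = (\<lambda>X. X), FArr = (\<lambda>X Y f. f)\<rparr>"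

definition comp_fnctr ::
    "('p, 'n, 'q, 'k) fnctr \<Rightarrow> ('o, 'm, 'p, 'n) fnctr \<Rightarrow> ('o, 'm, 'q, 'k) fnctr" where
  "comp_fnctr G F =
    \<lparr>FOb = (\<lambda>X. FOb G (FOb F X)),
     FArr = (\<lambda>X Y f. FArr G (FOb F X) (FOb F Y) (FArr F X Y f))\<rparr>"

locale natural_isomorphism = source: is_functor C D F + target: is_functor C D G
  for C :: "('o, 'm) cat" and D :: "('p, 'n) cat"
    and F :: "('o, 'm, 'p, 'n) fnctr" and G :: "('o, 'm, 'p, 'n) fnctr" +
  fixes \<tau> :: "'o \<Rightarrow> 'n"
  assumes component_iso: "X \<in> Ob C \<Longrightarrow> isomorphism D (FOb F X) (FOb G X) (\<tau> X)"
    and naturality: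
      "\<lbrakk>X \<in> Ob C; Y \<in> Ob C; f \<in> Hom C X Y\<rbrakk>
        \<Longrightarrow> Comp D (FOb F X) (FOb F Y) (FOb G Y) (\<tau> Y) (FArr F X Y f) =
            Comp D (FOb F X) (FOb G X) (FOb G Y) (FArr G X Y f) (\<tau> X)"

locale adjoint_equivalence =
  left: is_functor C D F + right: is_functor D C G +
  unit: natural_isomorphism C C id_fnctr "comp_fnctr G F" \<eta> +
  counit: natural_isomorphism D D "comp_fnctr F G" id_fnctr \<epsilon>
  for C :: "('o, 'm) cat" and D :: "('p, 'n) cat"
    and F :: "('o, 'm, 'p, 'n) fnctr" and G :: "('p, 'n, 'o, 'm) fnctr"
    and \<eta> :: "'o \<Rightarrow> 'm" and \<epsilon> :: "'p \<Rightarrow> 'n" +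
  assumes triangle_left:
      "X \<in> Ob C \<Longrightarrow>
        Comp D (FOb F X) (FOb F (FOb G (FOb F X))) (FOb F X)
          (\<epsilon> (FOb F X)) (FArr F X (FOb G (FOb F X)) (\<eta> X)) = Ident D (FOb F X)"
    and triangle_right:
      "Y \<in> Ob D \<Longrightarrow>
        Comp C (FOb G Y) (FOb G (FOb F (FOb G Y))) (FOb G Y)
          (FArr G (FOb F (FOb G Y)) Y (\<epsilon> Y)) (\<eta> (FOb G Y)) = Ident C (FOb G Y)"


section \<open>The categories \<open>AG\<^sub>\<bullet>\<close>, \<open>AG\<^sub>\<bullet>\<^sup>I\<close>, \<open>AR\<close> and the functor \<open>\<Gamma>\<close>\<close>

text \<open>
  Objects have their carriers inside the type \<open>'a\<close>, which plays the role of the universe and is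
  arbitrary.
\<close>

definition AG_pt :: "('a ordered_grp \<times> 'a, 'a \<Rightarrow> 'a) cat" where
  "AG_pt =
    \<lparr>Ob = {(A, a). archimedean_group (fst A) (snd A) \<and>
                   a \<in> carrier (fst A) \<and> a \<noteq> \<one>\<^bsub>fst A\<^esub>},
     Hom = (\<lambda>(A, a) (B, b). {f \<in> arch_hom A B. f a = b}),
     Ident = (\<lambda>(A, a). \<lambda>x \<in> carrier (fst A). x),
     Comp = (\<lambda>(A, a) Y Z g f. compose (carrier (fst A)) g f)\<rparr>"

definition initial_element :: "'a ordered_grp \<Rightarrow> 'a \<Rightarrow> bool" where
  "initial_element A i \<longleftrightarrow>
    i \<in> carrier (fst A) \<and> i \<noteq> \<one>\<^bsub>fst A\<^esub> \<and>
    (\<forall>a \<in> carrier (fst A). a \<noteq> \<one>\<^bsub>fst A\<^esub> \<longrightarrow> Hom AG_pt (A, i) (A, a) \<noteq> {})"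

definition AG_pt_I :: "('a ordered_grp \<times> 'a, 'a \<Rightarrow> 'a) cat" where
  "AG_pt_I = full_subcategory AG_pt (\<lambda>(A, i). initial_element A i)"

definition AR :: "('a ordered_rng, 'a \<Rightarrow> 'a) cat" where
  "AR =
    \<lparr>Ob = {R. archimedean_ring (fst R) (snd R)},
     Hom = (\<lambda>R S. ring_hom (fst R) (fst S) \<inter> arch_hom (underlying_group R) (underlying_group S)),
     Ident = (\<lambda>R. \<lambda>x \<in> carrier (fst R). x),
     Comp = (\<lambda>R S T g f. compose (carrier (fst R)) g f)\<rparr>"

definition Gamma :: "('a ordered_rng, 'a \<Rightarrow> 'a, 'a ordered_grp \<times> 'a, 'a \<Rightarrow> 'a) fnctr" where
  "Gamma = \<lparr>FOb = (\<lambda>R. (underlying_group R, \<one>\<^bsub>fst R\<^esub>)), FArr = (\<lambda>R S f. f)\<rparr>"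

end

theory Submission
  imports Defs Complex_Main
begin

text \<open>
  Everything rests on a form of Hoelder's theorem: for a nonzero element \<open>i\<close> of an Archimedean
  group \<open>A\<close> there is exactly one strictly monotone or strictly antitone homomorphism
  \<open>\<phi>: A \<rightarrow> \<real>\<close> with \<open>\<phi> i = 1\<close>, its coordinate (\<open>unit_coordinate_exists\<close>,
  \<open>unit_coordinate_unique\<close>). It increases if \<open>i\<close> is positive and decreases if \<open>i\<close> is negative.
  Uniqueness makes every morphism a scalar: for \<open>f: A \<rightarrow> B\<close> the map \<open>\<phi>\<^sub>B \<circ> f\<close> is again a
  monotone or antitone homomorphism to \<open>\<real>\<close>, hence \<open>\<phi>\<^sub>B (f x) = \<phi>\<^sub>B (f i) \<phi>\<^sub>A x\<close>
  (\<open>arch_hom_coordinate\<close>).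

  This has two consequences. If \<open>i\<close> is initial, an arrow \<open>(A, i) \<rightarrow> (A, x)\<close> multiplies coordinates
  by \<open>\<phi> x\<close>, so the image of \<open>\<phi>\<close> is closed under multiplication: it is a subring of \<open>\<real>\<close>, and its
  ring structure and order, carried back to \<open>A\<close> along \<open>\<phi>\<close>, make \<open>A\<close> an Archimedean ring
  with identity \<open>i\<close> (\<open>coordinate_ring_ob\<close>). In an Archimedean ring, right multiplication by a
  nonzero element is a morphism, so \<open>1\<close> is initial and the coordinate with \<open>\<phi> 1 = 1\<close> is
  multiplicative. Arrows preserving \<open>1\<close> preserve coordinates, and are therefore ring homomorphisms
  (\<open>unital_arch_hom_is_ring_hom\<close>): \<open>\<Gamma>\<close> is full and faithful.

  The quasi-inverse sends \<open>(A, i)\<close> to this ring. The order of the ring is that of \<open>A\<close> if \<open>i > 0\<close> and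
  the reversed order if \<open>i < 0\<close>, as \<open>1\<close> is always positive in an Archimedean ring. A morphism may be
  negative, so reversing an order changes no set of arrows, and all components of the unit and of
  the counit are identity maps.
\<close>

section \<open>Powers in an Archimedean group\<close>

definition weak_order :: "('a \<times> 'a) set \<Rightarrow> 'a \<Rightarrow> 'a \<Rightarrow> bool" where
  "weak_order r x y \<longleftrightarrow> x = y \<or> (x, y) \<in> r"

lemma weak_order_refl [simp]: "weak_order r x x"
  by (simp add: weak_order_def)

lemma weak_order_converse [simp]: "weak_order (r\<inverse>) x y \<longleftrightarrow> weak_order r y x"
  by (auto simp: weak_order_def)

context totally_ordered_group
begin

abbreviation leq (infix "\<preceq>" 50) where "x \<preceq> y \<equiv> weak_order r x y"

lemma less_irrefl: "(x, x) \<notin> r"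
  using less_linear by (auto simp: strict_linear_order_on_def irrefl_def)

lemma less_trans: "(x, y) \<in> r \<Longrightarrow> (y, z) \<in> r \<Longrightarrow> (x, z) \<in> r"
  using less_linear by (auto simp: strict_linear_order_on_def dest: transD)

lemma less_asym: "(x, y) \<in> r \<Longrightarrow> (y, x) \<notin> r"
  using less_irrefl less_trans by blast

lemma less_cases:
  assumes "x \<in> carrier G" "y \<in> carrier G"
  obtains "(x, y) \<in> r" | "x = y" | "(y, x) \<in> r"
  using less_linear assms unfolding strict_linear_order_on_def total_on_def by blast

lemma leq_trans: "x \<preceq> y \<Longrightarrow> y \<preceq> z \<Longrightarrow> x \<preceq> z"
  using less_trans by (auto simp: weak_order_def)

lemma leq_mult:
  assumes "x \<preceq> x'" "y \<preceq> y'"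
    and "x \<in> carrier G" "x' \<in> carrier G" "y \<in> carrier G" "y' \<in> carrier G"
  shows "x \<otimes> y \<preceq> x' \<otimes> y'"
proof -
  have "x \<otimes> y \<preceq> x' \<otimes> y" "x' \<otimes> y \<preceq> x' \<otimes> y'"
    using assms less_translate_left less_translate_right by (auto simp: weak_order_def)
  then show ?thesis by (rule leq_trans)
qed

lemma leq_pow:
  assumes "x \<preceq> y" "x \<in> carrier G" "y \<in> carrier G"
  shows "x [^] (n::nat) \<preceq> y [^] n"
proof (induction n)
  case (Suc n)
  then show ?case using leq_mult[OF Suc assms(1)] assms by simp
qed simp

text \<open>
  Reversal exchanges positive and negative elements, so that coordinates need only be constructed and
  compared for positive units. It also turns an inequality between powers into its mirror image.
\<close>

lemma reversed_totally_ordered_group: "totally_ordered_group G (r\<inverse>)"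
proof
  show "r\<inverse> \<subseteq> carrier G \<times> carrier G" using less_carrier by blast
  show "strict_linear_order_on (carrier G) (r\<inverse>)"
    using less_linear by (simp add: strict_linear_order_on_def)
qed (auto intro: less_translate_left less_translate_right)

lemma leq_mult_pow_left:
  assumes "a \<otimes> b \<preceq> b \<otimes> a" "a \<in> carrier G" "b \<in> carrier G"
  shows "a \<otimes> b [^] (n::nat) \<preceq> b [^] n \<otimes> a"
proof (induction n)
  case (Suc n)
  have "(a \<otimes> b [^] n) \<otimes> b \<preceq> (b [^] n \<otimes> a) \<otimes> b"
    by (rule leq_mult[OF Suc]) (use assms in auto)
  moreover have "b [^] n \<otimes> (a \<otimes> b) \<preceq> b [^] n \<otimes> (b \<otimes> a)"
    by (rule leq_mult[OF _ assms(1)]) (use assms in auto)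
  ultimately show ?case using assms leq_trans by (simp add: m_assoc)
qed (use assms in simp)

lemma leq_mult_pow_right:
  assumes "a \<otimes> b \<preceq> b \<otimes> a" "a \<in> carrier G" "b \<in> carrier G"
  shows "a [^] (n::nat) \<otimes> b \<preceq> b \<otimes> a [^] n"
proof -
  interpret op: totally_ordered_group G "r\<inverse>" by (rule reversed_totally_ordered_group)
  show ?thesis
    using op.leq_mult_pow_left[of b a n] assms by auto
qed

lemma pow_mult_leq_pow:
  assumes "a \<otimes> b \<preceq> b \<otimes> a" "a \<in> carrier G" "b \<in> carrier G"
  shows "a [^] (n::nat) \<otimes> b [^] n \<preceq> (a \<otimes> b) [^] n"
proof (induction n)
  case (Suc n)
  have c: "a [^] n \<in> carrier G" "b [^] n \<in> carrier G" "(a \<otimes> b) [^] n \<in> carrier G"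
    using assms by auto
  \<comment> \<open>Moving the inner \<open>b\<close> to the left past \<open>a [^] n\<close> can only increase the product.\<close>
  have "a [^] Suc n \<otimes> b [^] Suc n = (a \<otimes> (a [^] n \<otimes> b)) \<otimes> b [^] n"
    using assms c nat_pow_Suc2[of b n] nat_pow_Suc2[of a n] by (simp add: m_assoc del: nat_pow_Suc)
  moreover have "(a \<otimes> (a [^] n \<otimes> b)) \<otimes> b [^] n \<preceq> (a \<otimes> (b \<otimes> a [^] n)) \<otimes> b [^] n"
    by (rule leq_mult[OF leq_mult[OF _ leq_mult_pow_right[OF assms]]]) (use assms c in auto)
  moreover have "(a \<otimes> (b \<otimes> a [^] n)) \<otimes> b [^] n = (a \<otimes> b) \<otimes> (a [^] n \<otimes> b [^] n)"
    using assms c by (simp add: m_assoc)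
  moreover have "(a \<otimes> b) \<otimes> (a [^] n \<otimes> b [^] n) \<preceq> (a \<otimes> b) \<otimes> (a \<otimes> b) [^] n"
    by (rule leq_mult[OF _ Suc]) (use assms c in auto)
  moreover have "(a \<otimes> b) \<otimes> (a \<otimes> b) [^] n = (a \<otimes> b) [^] Suc n"
    using assms nat_pow_Suc2[of "a \<otimes> b" n] by simp
  ultimately show ?case using leq_trans by metis
qed simp

text \<open>
  Commutativity of an Archimedean group will follow from the additivity of its coordinate, so using
  \<open>(a \<otimes> b) [^] n = a [^] n \<otimes> b [^] n\<close> to prove additivity would be circular. This squeeze takes its
  place.
\<close>

lemma pow_mult_squeeze:
  assumes "a \<otimes> b \<preceq> b \<otimes> a" "a \<in> carrier G" "b \<in> carrier G" "c \<in> {a \<otimes> b, b \<otimes> a}"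
  shows "a [^] (n::nat) \<otimes> b [^] n \<preceq> c [^] n" "c [^] n \<preceq> b [^] n \<otimes> a [^] n"
proof -
  interpret op: totally_ordered_group G "r\<inverse>" by (rule reversed_totally_ordered_group)
  have 1: "a [^] n \<otimes> b [^] n \<preceq> (a \<otimes> b) [^] n"
    by (rule pow_mult_leq_pow[OF assms(1-3)])
  have 2: "(a \<otimes> b) [^] n \<preceq> (b \<otimes> a) [^] n"
    by (rule leq_pow) (use assms in auto)
  have 3: "(b \<otimes> a) [^] n \<preceq> b [^] n \<otimes> a [^] n"
    using op.pow_mult_leq_pow[of b a n] assms by auto
  show "a [^] n \<otimes> b [^] n \<preceq> c [^] n" "c [^] n \<preceq> b [^] n \<otimes> a [^] n"
    using assms(4) 1 2 3 leq_trans by blast+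
qed

lemma int_pow_strict_mono:
  assumes "(\<one>, i) \<in> r" "j < k"
  shows "(i [^] (j::int), i [^] k) \<in> r"
proof -
  have i: "i \<in> carrier G" using assms less_carrier by auto
  have "(i [^] j, i [^] (j + int (Suc n))) \<in> r" for n
  proof (induction n)
    case 0
    have "(i [^] j \<otimes> \<one>, i [^] j \<otimes> i) \<in> r"
      by (rule less_translate_left) (use assms i in auto)
    then show ?case using i by (simp add: int_pow_mult)
  next
    case (Suc n)
    have "(i [^] (j + int (Suc n)) \<otimes> \<one>, i [^] (j + int (Suc n)) \<otimes> i) \<in> r"
      by (rule less_translate_left) (use assms i in auto)
    moreover have "i [^] (j + int (Suc n)) \<otimes> i = i [^] (j + int (Suc (Suc n)))"
      using i int_pow_mult[of i "j + int (Suc n)" 1] by (simp add: algebra_simps)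
    ultimately have "(i [^] (j + int (Suc n)), i [^] (j + int (Suc (Suc n)))) \<in> r"
      using i by simp
    with Suc show ?case using less_trans by blast
  qed
  from this[of "nat (k - j - 1)"] assms show ?thesis by simp
qed

lemma int_pow_leq_iff:
  assumes "(\<one>, i) \<in> r"
  shows "i [^] (j::int) \<preceq> i [^] k \<longleftrightarrow> j \<le> k"
  using int_pow_strict_mono[OF assms, of j k] int_pow_strict_mono[OF assms, of k j]
    less_asym less_irrefl
  by (cases j k rule: linorder_cases) (auto simp: weak_order_def)

lemma pos_cases:
  assumes "i \<in> carrier G" "i \<noteq> \<one>"
  shows "(\<one>, i) \<in> r \<or> (\<one>, i) \<in> r\<inverse>"
  using less_cases[OF assms(1) one_closed] assms(2) by blast

end

lemma (in archimedean_group) reversed_archimedean_group: "archimedean_group G (r\<inverse>)"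
proof -
  interpret op: totally_ordered_group G "r\<inverse>" by (rule reversed_totally_ordered_group)
  show ?thesis
    by unfold_locales (use archimedean_pos archimedean_neg in auto)
qed

context archimedean_group
begin

text \<open>
  The coordinate of \<open>z\<close> with respect to the unit \<open>i\<close> lies between the integers \<open>k\<close> and \<open>k + 1\<close>.
  Applied to \<open>z = x [^] n\<close>, it determines the coordinate of \<open>x\<close> up to \<open>1 / n\<close>.
\<close>

lemma floor_exists:
  assumes i: "(\<one>, i) \<in> r" and z: "z \<in> carrier G"
  obtains k :: int where "i [^] k \<preceq> z" "z \<preceq> i [^] (k + 1)"
proof -
  have ic: "i \<in> carrier G" using i less_carrier by auto
  have inv: "(inv i, \<one>) \<in> r"
    using less_translate_left[OF i, of "inv i"] ic by simp
  have "\<exists>M::int. (z, i [^] M) \<in> r"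
  proof (cases rule: less_cases[OF z one_closed])
    case 1
    then show ?thesis by (intro exI[of _ 0]) simp
  next
    case 2
    with i ic show ?thesis by (intro exI[of _ 1]) simp
  next
    case 3
    then obtain n :: nat where "(z, i [^] n) \<in> r" using archimedean_pos i by blast
    then show ?thesis by (intro exI[of _ "int n"]) (simp add: int_pow_int)
  qed
  then obtain M :: int where M: "(z, i [^] M) \<in> r" by blast
  have "\<exists>m::int. (i [^] m, z) \<in> r"
  proof (cases rule: less_cases[OF z one_closed])
    case 1
    then obtain n :: nat where "(inv i [^] n, z) \<in> r" using archimedean_neg inv by blast
    then show ?thesis
      using ic by (intro exI[of _ "- int n"]) (simp add: int_pow_neg int_pow_int nat_pow_inv)
  next
    case 2
    with inv ic show ?thesis by (intro exI[of _ "-1"]) (simp add: int_pow_neg)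
  next
    case 3
    then show ?thesis by (intro exI[of _ 0]) simp
  qed
  then obtain m :: int where m: "(i [^] m, z) \<in> r" by blast
  define P where "P n \<longleftrightarrow> (z, i [^] (m + int n)) \<in> r" for n
  have "m < M"
    using int_pow_leq_iff[OF i, of m M] less_trans[OF m M] less_irrefl
    by (auto simp: weak_order_def less_le)
  then have "P (nat (M - m))" using M by (simp add: P_def)
  moreover have "\<not> P 0" using m less_asym by (simp add: P_def)
  ultimately obtain n where n: "\<not> P n" "P (Suc n)"
    using nat_induct[of "\<lambda>n. \<not> P n"] by blast
  have "i [^] (m + int n) \<preceq> z"
    using n(1) less_cases[OF int_pow_closed[OF ic, of "m + int n"] z]
    unfolding P_def weak_order_def by blast
  moreover have "z \<preceq> i [^] (m + int n + 1)"
    using n(2) by (simp add: P_def weak_order_def algebra_simps)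
  ultimately show ?thesis by (rule that)
qed

end

section \<open>The real coordinate of an Archimedean group\<close>

text \<open>
  Allowing both directions of monotonicity makes the notion independent of the sign of \<open>i\<close> and
  invariant under reversal of the order.
\<close>

definition unit_coordinate ::
    "('a, 'm) monoid_scheme \<Rightarrow> ('a \<times> 'a) set \<Rightarrow> 'a \<Rightarrow> ('a \<Rightarrow> real) \<Rightarrow> bool" where
  "unit_coordinate G r i \<phi> \<longleftrightarrow>
    (\<forall>x \<in> carrier G. \<forall>y \<in> carrier G. \<phi> (x \<otimes>\<^bsub>G\<^esub> y) = \<phi> x + \<phi> y) \<and>
    (positive_map r {(s, t). s < t} \<phi> \<or> negative_map r {(s, t). s < t} \<phi>) \<and>
    \<phi> i = 1"

lemma unit_coordinate_converse [simp]:
  "unit_coordinate G (r\<inverse>) i = unit_coordinate G r i"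
  by (auto simp: unit_coordinate_def positive_map_def negative_map_def fun_eq_iff)

lemma unit_coordinate_mult:
  "unit_coordinate G r i \<phi> \<Longrightarrow> x \<in> carrier G \<Longrightarrow> y \<in> carrier G \<Longrightarrow>
    \<phi> (x \<otimes>\<^bsub>G\<^esub> y) = \<phi> x + \<phi> y"
  by (simp add: unit_coordinate_def)

lemma (in group) unit_coordinate_one:
  "unit_coordinate G r i \<phi> \<Longrightarrow> \<phi> \<one> = 0"
  using unit_coordinate_mult[of G r i \<phi> \<one> \<one>] by simp

lemma (in group) unit_coordinate_inv:
  "unit_coordinate G r i \<phi> \<Longrightarrow> x \<in> carrier G \<Longrightarrow> \<phi> (inv x) = - \<phi> x"
  using unit_coordinate_mult[of G r i \<phi> x "inv x"] unit_coordinate_one[of r i \<phi>] by simp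

lemma (in group) unit_coordinate_pow:
  assumes "unit_coordinate G r i \<phi>" "x \<in> carrier G"
  shows "\<phi> (x [^] (n::nat)) = real n * \<phi> x"
proof (induction n)
  case (Suc n)
  then show ?case
    using assms unit_coordinate_mult[OF assms(1), of "x [^] n" x] by (simp add: algebra_simps)
qed (use assms unit_coordinate_one in auto)

lemma (in group) unit_coordinate_int_pow:
  assumes "unit_coordinate G r i \<phi>" "i \<in> carrier G"
  shows "\<phi> (i [^] (k::int)) = real_of_int k"
proof -
  have 1: "\<phi> i = 1" using assms by (simp add: unit_coordinate_def)
  show ?thesis
    using unit_coordinate_pow[OF assms] unit_coordinate_inv[OF assms(1)] assms(2) 1
    by (cases k rule: int_cases2) (auto simp: int_pow_int int_pow_neg)
qed

lemma (in totally_ordered_group) unit_coordinate_inj_on: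
  assumes "unit_coordinate G r i \<phi>"
  shows "inj_on \<phi> (carrier G)"
proof (rule inj_onI)
  fix x y assume xy: "x \<in> carrier G" "y \<in> carrier G" "\<phi> x = \<phi> y"
  then show "x = y"
    using assms by (cases rule: less_cases[OF xy(1,2)])
      (fastforce simp: unit_coordinate_def positive_map_def negative_map_def)+
qed

lemma eq_zero_if_multiples_bounded:
  fixes d C :: real
  assumes "\<And>n::nat. n \<ge> 1 \<Longrightarrow> real n * \<bar>d\<bar> \<le> C"
  shows "d = 0"
proof (rule ccontr)
  assume "d \<noteq> 0"
  then obtain n :: nat where n: "C < real n * \<bar>d\<bar>"
    using reals_Archimedean3[of "\<bar>d\<bar>"] by auto
  also have "\<dots> \<le> real (Suc n) * \<bar>d\<bar>" by (simp add: algebra_simps)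
  finally show False using assms[of "Suc n"] by simp
qed

context archimedean_group
begin

lemma unit_coordinate_leq:
  assumes i: "(\<one>, i) \<in> r" and \<phi>: "unit_coordinate G r i \<phi>" and xy: "x \<preceq> y"
  shows "\<phi> x \<le> \<phi> y"
proof -
  have "\<phi> \<one> < \<phi> i" using unit_coordinate_one[OF \<phi>] \<phi> by (simp add: unit_coordinate_def)
  then have "positive_map r {(s, t). s < t} \<phi>"
    using \<phi> i by (fastforce simp: unit_coordinate_def negative_map_def)
  then show ?thesis using xy by (auto simp: positive_map_def weak_order_def less_imp_le)
qed

text \<open>
  Evaluating a coordinate on \<open>i [^] k \<preceq> x [^] n \<preceq> i [^] (k + 1)\<close> shows that \<open>n \<phi>(x)\<close> lies between
  \<open>k\<close> and \<open>k + 1\<close>. Two coordinates thus differ at \<open>x\<close> by at most \<open>1 / n\<close>, for all \<open>n\<close>.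
\<close>

lemma unit_coordinate_unique_pos:
  assumes i: "(\<one>, i) \<in> r" and \<phi>: "unit_coordinate G r i \<phi>" and \<psi>: "unit_coordinate G r i \<psi>"
    and x: "x \<in> carrier G"
  shows "\<phi> x = \<psi> x"
proof -
  have ic: "i \<in> carrier G" using i less_carrier by auto
  have "real n * \<bar>\<phi> x - \<psi> x\<bar> \<le> 1" for n
  proof -
    obtain k :: int where k: "i [^] k \<preceq> x [^] n" "x [^] n \<preceq> i [^] (k + 1)"
      using floor_exists[OF i, of "x [^] n"] x by auto
    have "real_of_int k \<le> real n * \<chi> x \<and> real n * \<chi> x \<le> real_of_int k + 1"
      if \<chi>: "unit_coordinate G r i \<chi>" for \<chi>
      using unit_coordinate_leq[OF i \<chi> k(1)] unit_coordinate_leq[OF i \<chi> k(2)]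
        unit_coordinate_pow[OF \<chi> x] unit_coordinate_int_pow[OF \<chi> ic] by simp
    from this[OF \<phi>] this[OF \<psi>] have "\<bar>real n * (\<phi> x - \<psi> x)\<bar> \<le> 1"
      unfolding right_diff_distrib by linarith
    then show ?thesis by (simp add: abs_mult)
  qed
  then have "\<phi> x - \<psi> x = 0" by (rule eq_zero_if_multiples_bounded)
  then show ?thesis by simp
qed

text \<open>
  The coordinate of \<open>x\<close> is the supremum of the fractions \<open>m / n\<close> with \<open>i [^] m \<preceq> x [^] n\<close>. Rounding
  \<open>n \<phi>(x)\<close>, \<open>n \<phi>(y)\<close> and \<open>n \<phi>(x \<otimes> y)\<close> to integers and comparing powers of \<open>i\<close> bounds
  \<open>n (\<phi>(x \<otimes> y) - \<phi>(x) - \<phi>(y))\<close> independently of \<open>n\<close>, which forces additivity.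
\<close>

lemma unit_coordinate_exists_pos:
  assumes i: "(\<one>, i) \<in> r"
  shows "\<exists>\<phi>. unit_coordinate G r i \<phi>"
proof -
  have ic: "i \<in> carrier G" using i less_carrier by auto
  define S where "S x = {real_of_int m / real n | m n. n \<ge> 1 \<and> i [^] m \<preceq> x [^] n}" for x
  define \<phi> where "\<phi> x = Sup (S x)" for x
  have below: "m * int n \<le> k * int l"
    if "i [^] m \<preceq> x [^] l" "x [^] n \<preceq> i [^] k" "x \<in> carrier G"
    for m k :: int and n l :: nat and x
  proof -
    have "(i [^] m) [^] n \<preceq> (x [^] l) [^] n" "(x [^] n) [^] l \<preceq> (i [^] k) [^] l"
      using leq_pow[OF that(1), of n] leq_pow[OF that(2), of l] that(3) ic by simp_all
    moreover have "(x [^] l) [^] n = (x [^] n) [^] l"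
      using that by (simp add: nat_pow_pow mult.commute)
    moreover have "(i [^] m) [^] n = i [^] (m * int n)" "(i [^] k) [^] l = i [^] (k * int l)"
      using int_pow_pow[OF ic, of m "int n"] int_pow_pow[OF ic, of k "int l"]
      by (simp_all only: int_pow_int)
    ultimately show ?thesis
      using leq_trans[of "i [^] (m * int n)" "(x [^] n) [^] l" "i [^] (k * int l)"]
        int_pow_leq_iff[OF i] by simp
  qed
  have bracket: "real_of_int k \<le> real n * \<phi> x \<and> real n * \<phi> x \<le> real_of_int k + 1"
    if k: "i [^] k \<preceq> x [^] n" "x [^] n \<preceq> i [^] (k + 1)"
      and n: "n \<ge> 1" and x: "x \<in> carrier G"
    for k and n :: nat and x
  proof -
    have ub: "s \<le> (real_of_int k + 1) / real n" if "s \<in> S x" for s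
    proof -
      from that obtain m l where s: "s = real_of_int m / real l" "l \<ge> 1" "i [^] m \<preceq> x [^] l"
        by (auto simp: S_def)
      from below[OF s(3) k(2) x] have "real_of_int (m * int n) \<le> real_of_int ((k + 1) * int l)"
        by (rule of_int_le_iff[THEN iffD2])
      then show ?thesis using s(1,2) n by (simp add: pos_divide_le_eq pos_le_divide_eq)
    qed
    have mem: "real_of_int k / real n \<in> S x" using k n by (auto simp: S_def)
    have "real_of_int k / real n \<le> \<phi> x"
      unfolding \<phi>_def by (rule cSup_upper[OF mem]) (use ub in \<open>auto simp: bdd_above_def\<close>)
    moreover have "\<phi> x \<le> (real_of_int k + 1) / real n"
      unfolding \<phi>_def by (rule cSup_least) (use mem ub in auto)
    ultimately show ?thesis using n by (simp add: field_simps)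
  qed
  have add: "\<phi> (x \<otimes> y) = \<phi> x + \<phi> y" if x: "x \<in> carrier G" and y: "y \<in> carrier G" for x y
  proof -
    \<comment> \<open>Any bound independent of \<open>n\<close> suffices: each rounding costs at most \<open>1\<close>, and the rounded
      values \<open>k\<close>, \<open>l\<close>, \<open>p\<close> satisfy \<open>k + l - 1 \<le> p \<le> k + l + 2\<close>.\<close>
    have "real n * \<bar>\<phi> (x \<otimes> y) - \<phi> x - \<phi> y\<bar> \<le> 5" if n: "n \<ge> 1" for n :: nat
    proof -
      obtain k :: int where k: "i [^] k \<preceq> x [^] n" "x [^] n \<preceq> i [^] (k + 1)"
        using floor_exists[OF i, of "x [^] n"] x by auto
      obtain l :: int where l: "i [^] l \<preceq> y [^] n" "y [^] n \<preceq> i [^] (l + 1)"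
        using floor_exists[OF i, of "y [^] n"] y by auto
      obtain p :: int where p: "i [^] p \<preceq> (x \<otimes> y) [^] n"
          "(x \<otimes> y) [^] n \<preceq> i [^] (p + 1)"
        using floor_exists[OF i, of "(x \<otimes> y) [^] n"] x y by auto
      have lower: "i [^] (k + l) \<preceq> x [^] n \<otimes> y [^] n"
          "i [^] (k + l) \<preceq> y [^] n \<otimes> x [^] n"
        using leq_mult[OF k(1) l(1)] leq_mult[OF l(1) k(1)] x y ic
          int_pow_mult[OF ic, of k l] int_pow_mult[OF ic, of l k]
        by (simp_all add: add.commute)
      have upper: "x [^] n \<otimes> y [^] n \<preceq> i [^] (k + l + 2)"
          "y [^] n \<otimes> x [^] n \<preceq> i [^] (k + l + 2)"
      proof -
        have "i [^] (k + 1) \<otimes> i [^] (l + 1) = i [^] (k + l + 2)"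
             "i [^] (l + 1) \<otimes> i [^] (k + 1) = i [^] (k + l + 2)"
          using int_pow_mult[OF ic, of "k + 1" "l + 1"] int_pow_mult[OF ic, of "l + 1" "k + 1"]
          by (simp_all add: algebra_simps)
        then show "x [^] n \<otimes> y [^] n \<preceq> i [^] (k + l + 2)"
            "y [^] n \<otimes> x [^] n \<preceq> i [^] (k + l + 2)"
          using leq_mult[OF k(2) l(2)] leq_mult[OF l(2) k(2)] x y ic by simp_all
      qed
      have "x \<otimes> y \<preceq> y \<otimes> x \<or> y \<otimes> x \<preceq> x \<otimes> y"
        using less_cases[of "x \<otimes> y" "y \<otimes> x"] x y unfolding weak_order_def by blast
      then have "i [^] (k + l) \<preceq> (x \<otimes> y) [^] n" "(x \<otimes> y) [^] n \<preceq> i [^] (k + l + 2)"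
        using pow_mult_squeeze[of x y "x \<otimes> y" n] pow_mult_squeeze[of y x "x \<otimes> y" n]
          x y lower upper leq_trans by blast+
      then have "k + l \<le> p + 1" "p \<le> k + l + 2"
        using leq_trans[OF _ p(2)] leq_trans[OF p(1)] int_pow_leq_iff[OF i] by blast+
      then have "real_of_int k + real_of_int l \<le> real_of_int p + 1"
          "real_of_int p \<le> real_of_int k + real_of_int l + 2" by linarith+
      moreover have "x \<otimes> y \<in> carrier G" using x y by simp
      ultimately have "\<bar>real n * \<phi> (x \<otimes> y) - real n * \<phi> x - real n * \<phi> y\<bar> \<le> 5"
        using bracket[OF k n x] bracket[OF l n y] bracket[OF p n] by linarith
      then have "\<bar>real n * (\<phi> (x \<otimes> y) - \<phi> x - \<phi> y)\<bar> \<le> 5"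
        by (simp add: right_diff_distrib)
      then show ?thesis by (simp add: abs_mult)
    qed
    then have "\<phi> (x \<otimes> y) - \<phi> x - \<phi> y = 0" by (rule eq_zero_if_multiples_bounded)
    then show ?thesis by simp
  qed
  have one: "\<phi> \<one> = 0" using add[of \<one> \<one>] by simp
  have pos: "0 < \<phi> x" if x: "(\<one>, x) \<in> r" for x
  proof -
    have xc: "x \<in> carrier G" using x less_carrier by auto
    obtain n :: nat where n: "n \<ge> 1" "(i, x [^] n) \<in> r" using archimedean_pos[OF i x] by blast
    obtain k :: int where k: "i [^] k \<preceq> x [^] n" "x [^] n \<preceq> i [^] (k + 1)"
      using floor_exists[OF i, of "x [^] n"] xc by auto
    have "(i [^] (1::int), x [^] n) \<in> r" using n ic by simp
    then have "(i [^] (1::int), i [^] (k + 1)) \<in> r"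
      using k(2) less_trans by (auto simp: weak_order_def)
    then have "\<not> i [^] (k + 1) \<preceq> i [^] (1::int)"
      using less_asym less_irrefl by (auto simp: weak_order_def)
    then have "\<not> k + 1 \<le> 1" using int_pow_leq_iff[OF i] by blast
    then have "1 \<le> real n * \<phi> x" using bracket[OF k n(1) xc] by linarith
    then show ?thesis using n by (metis mult_nonneg_nonpos not_le not_one_le_zero of_nat_0_le_iff
        order_trans)
  qed
  have "positive_map r {(s, t). s < t} \<phi>"
    unfolding positive_map_def
  proof (intro allI impI)
    fix x y assume xy: "(x, y) \<in> r"
    then have c: "x \<in> carrier G" "y \<in> carrier G" using less_carrier by auto
    have "(\<one>, inv x \<otimes> y) \<in> r" using less_translate_left[OF xy, of "inv x"] c by simp
    then have "0 < \<phi> (inv x \<otimes> y)" by (rule pos)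
    moreover have "\<phi> y = \<phi> x + \<phi> (inv x \<otimes> y)"
      using add[of x "inv x \<otimes> y"] c by (simp flip: m_assoc)
    ultimately show "(\<phi> x, \<phi> y) \<in> {(s, t). s < t}" by simp
  qed
  moreover have "\<phi> i = 1"
  proof -
    have "real n * \<bar>\<phi> i - 1\<bar> \<le> 1" if "n \<ge> 1" for n :: nat
    proof -
      have "real_of_int (int n) \<le> real n * \<phi> i \<and> real n * \<phi> i \<le> real_of_int (int n) + 1"
        by (rule bracket)
          (use that ic int_pow_leq_iff[OF i, of "int n" "int n + 1"] in \<open>auto simp: int_pow_int\<close>)
      then have "\<bar>real n * (\<phi> i - 1)\<bar> \<le> 1" by (simp add: right_diff_distrib)
      then show ?thesis by (simp add: abs_mult)
    qed
    then have "\<phi> i - 1 = 0" by (rule eq_zero_if_multiples_bounded)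
    then show ?thesis by simp
  qed
  ultimately show ?thesis using add unfolding unit_coordinate_def by blast
qed

lemma unit_coordinate_unique:
  assumes "i \<in> carrier G" "i \<noteq> \<one>" "unit_coordinate G r i \<phi>" "unit_coordinate G r i \<psi>"
    and "x \<in> carrier G"
  shows "\<phi> x = \<psi> x"
  using pos_cases[OF assms(1,2)]
proof
  assume "(\<one>, i) \<in> r"
  then show ?thesis using assms(3-5) by (rule unit_coordinate_unique_pos)
next
  interpret op: archimedean_group G "r\<inverse>" by (rule reversed_archimedean_group)
  assume "(\<one>, i) \<in> r\<inverse>"
  then show ?thesis
    by (rule op.unit_coordinate_unique_pos) (simp_all only: unit_coordinate_converse assms)
qed

lemma unit_coordinate_exists:
  assumes "i \<in> carrier G" "i \<noteq> \<one>"
  shows "\<exists>\<phi>. unit_coordinate G r i \<phi>"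
  using pos_cases[OF assms]
proof
  assume "(\<one>, i) \<in> r"
  then show ?thesis by (rule unit_coordinate_exists_pos)
next
  interpret op: archimedean_group G "r\<inverse>" by (rule reversed_archimedean_group)
  assume "(\<one>, i) \<in> r\<inverse>"
  from op.unit_coordinate_exists_pos[OF this] show ?thesis
    by (simp only: unit_coordinate_converse)
qed

end

section \<open>Objects and arrows through the real coordinate\<close>

lemma AG_pt_ob_iff:
  "(A, i) \<in> Ob AG_pt \<longleftrightarrow>
    archimedean_group (fst A) (snd A) \<and> i \<in> carrier (fst A) \<and> i \<noteq> \<one>\<^bsub>fst A\<^esub>"
  by (simp add: AG_pt_def)

lemma AG_pt_I_ob_iff:
  "(A, i) \<in> Ob AG_pt_I \<longleftrightarrow> (A, i) \<in> Ob AG_pt \<and> initial_element A i"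
  by (simp add: AG_pt_I_def full_subcategory_def)

lemma AG_pt_hom: "Hom AG_pt (A, a) (B, b) = {f \<in> arch_hom A B. f a = b}"
  by (simp add: AG_pt_def)

lemma AR_ob_iff: "R \<in> Ob AR \<longleftrightarrow> archimedean_ring (fst R) (snd R)"
  by (simp add: AR_def)

definition coordinate :: "'a ordered_grp \<Rightarrow> 'a \<Rightarrow> 'a \<Rightarrow> real" where
  "coordinate A i = (SOME \<phi>. unit_coordinate (fst A) (snd A) i \<phi>)"

lemma unit_coordinate_coordinate:
  assumes "(A, i) \<in> Ob AG_pt"
  shows "unit_coordinate (fst A) (snd A) i (coordinate A i)"
proof -
  interpret archimedean_group "fst A" "snd A" using assms by (simp add: AG_pt_ob_iff)
  have "\<exists>\<phi>. unit_coordinate (fst A) (snd A) i \<phi>"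
    by (rule unit_coordinate_exists) (use assms in \<open>auto simp: AG_pt_ob_iff\<close>)
  then show ?thesis unfolding coordinate_def by (rule someI_ex)
qed

lemma coordinate_unit [simp]: "(A, i) \<in> Ob AG_pt \<Longrightarrow> coordinate A i i = 1"
  using unit_coordinate_coordinate[of A i] by (simp add: unit_coordinate_def)

lemma coordinate_one:
  assumes "(A, i) \<in> Ob AG_pt"
  shows "coordinate A i \<one>\<^bsub>fst A\<^esub> = 0"
proof -
  interpret archimedean_group "fst A" "snd A" using assms by (simp add: AG_pt_ob_iff)
  show ?thesis by (rule unit_coordinate_one[OF unit_coordinate_coordinate[OF assms]])
qed

lemma coordinate_mult:
  "(A, i) \<in> Ob AG_pt \<Longrightarrow> x \<in> carrier (fst A) \<Longrightarrow> y \<in> carrier (fst A) \<Longrightarrow>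
    coordinate A i (x \<otimes>\<^bsub>fst A\<^esub> y) = coordinate A i x + coordinate A i y"
  using unit_coordinate_coordinate[of A i] by (simp add: unit_coordinate_def)

lemma inj_on_coordinate:
  assumes "(A, i) \<in> Ob AG_pt"
  shows "inj_on (coordinate A i) (carrier (fst A))"
proof -
  interpret archimedean_group "fst A" "snd A" using assms by (simp add: AG_pt_ob_iff)
  show ?thesis by (rule unit_coordinate_inj_on[OF unit_coordinate_coordinate[OF assms]])
qed

text \<open>
  In coordinates a morphism is multiplication by a constant: divided by its value at \<open>a\<close>, the map
  \<open>coordinate B b \<circ> f\<close> is a coordinate of \<open>A\<close> with unit \<open>a\<close>, and there is only one.
\<close>

lemma arch_hom_coordinate:
  assumes A: "(A, a) \<in> Ob AG_pt" and B: "(B, b) \<in> Ob AG_pt" and f: "f \<in> arch_hom A B"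
    and x: "x \<in> carrier (fst A)"
  shows "coordinate B b (f x) = coordinate B b (f a) * coordinate A a x"
proof -
  interpret A: archimedean_group "fst A" "snd A" using A by (simp add: AG_pt_ob_iff)
  interpret B: archimedean_group "fst B" "snd B" using B by (simp add: AG_pt_ob_iff)
  have a: "a \<in> carrier (fst A)" "a \<noteq> \<one>\<^bsub>fst A\<^esub>" using A by (auto simp: AG_pt_ob_iff)
  have fh: "f \<in> hom (fst A) (fst B)" using f by (simp add: arch_hom_def)
  define \<psi> where "\<psi> = coordinate B b"
  define c where "c = \<psi> (f a)"
  have \<psi>: "unit_coordinate (fst B) (snd B) b \<psi>"
    unfolding \<psi>_def by (rule unit_coordinate_coordinate[OF B])
  have mono: "positive_map (snd A) {(s, t). s < t} (\<psi> \<circ> f) \<or>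
      negative_map (snd A) {(s, t). s < t} (\<psi> \<circ> f)"
    using f \<psi> unfolding arch_hom_def unit_coordinate_def positive_map_def negative_map_def
    by fastforce
  have add: "\<psi> (f (y \<otimes>\<^bsub>fst A\<^esub> z)) = \<psi> (f y) + \<psi> (f z)"
    if "y \<in> carrier (fst A)" "z \<in> carrier (fst A)" for y z
    using that fh unit_coordinate_mult[OF \<psi>] by (simp add: hom_mult hom_in_carrier)
  have "\<psi> (f \<one>\<^bsub>fst A\<^esub>) = 0" using add[of "\<one>\<^bsub>fst A\<^esub>" "\<one>\<^bsub>fst A\<^esub>"] by simp
  then have c0: "c \<noteq> 0"
    using A.pos_cases[OF a] mono by (fastforce simp: c_def positive_map_def negative_map_def)
  have "unit_coordinate (fst A) (snd A) a (\<lambda>y. \<psi> (f y) / c)"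
  proof -
    have "positive_map (snd A) {(s, t). s < t} (\<lambda>y. \<psi> (f y) / c) \<or>
        negative_map (snd A) {(s, t). s < t} (\<lambda>y. \<psi> (f y) / c)"
    proof (cases "c > 0")
      case True
      then show ?thesis
        using mono by (simp add: positive_map_def negative_map_def divide_less_cancel)
    next
      case False
      with c0 have "c < 0" by simp
      then show ?thesis
        using mono by (auto simp: positive_map_def negative_map_def divide_less_cancel)
    qed
    then show ?thesis
      using add c0 unfolding unit_coordinate_def by (simp add: add_divide_distrib c_def)
  qed
  from A.unit_coordinate_unique[OF a this unit_coordinate_coordinate[OF A] x]
  show ?thesis using c0 by (simp add: \<psi>_def c_def field_simps)
qed

lemma coordinate_order_cases:
  assumes A: "(A, i) \<in> Ob AG_pt"
  defines "s \<equiv> {(x, y). x \<in> carrier (fst A) \<and> y \<in> carrier (fst A) \<and>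
    coordinate A i x < coordinate A i y}"
  shows "s = snd A \<or> s = (snd A)\<inverse>"
proof -
  interpret A: archimedean_group "fst A" "snd A" using A by (simp add: AG_pt_ob_iff)
  have c: "(x, y) \<in> snd A \<Longrightarrow> x \<in> carrier (fst A) \<and> y \<in> carrier (fst A)" for x y
    using A.less_carrier by auto
  from unit_coordinate_coordinate[OF A]
  consider "positive_map (snd A) {(s, t). s < t} (coordinate A i)"
    | "negative_map (snd A) {(s, t). s < t} (coordinate A i)"
    by (auto simp: unit_coordinate_def)
  then show ?thesis
  proof cases
    case 1
    then have m: "(x, y) \<in> snd A \<Longrightarrow> coordinate A i x < coordinate A i y" for x y
      by (auto simp: positive_map_def)
    have "(x, y) \<in> s \<longleftrightarrow> (x, y) \<in> snd A" for x y
    proof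
      assume xy: "(x, y) \<in> s"
      then have "x \<in> carrier (fst A)" "y \<in> carrier (fst A)" by (auto simp: s_def)
      then show "(x, y) \<in> snd A"
        by (cases rule: A.less_cases[of x y]) (use xy m[of y x] in \<open>auto simp: s_def\<close>)
    qed (use c m in \<open>auto simp: s_def\<close>)
    then show ?thesis by auto
  next
    case 2
    then have m: "(x, y) \<in> snd A \<Longrightarrow> coordinate A i y < coordinate A i x" for x y
      by (auto simp: negative_map_def)
    have "(x, y) \<in> s \<longleftrightarrow> (x, y) \<in> (snd A)\<inverse>" for x y
    proof
      assume xy: "(x, y) \<in> s"
      then have "x \<in> carrier (fst A)" "y \<in> carrier (fst A)" by (auto simp: s_def)
      then show "(x, y) \<in> (snd A)\<inverse>"
        by (cases rule: A.less_cases[of x y]) (use xy m[of x y] in \<open>auto simp: s_def\<close>)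
    qed (use c m in \<open>auto simp: s_def\<close>)
    then show ?thesis by auto
  qed
qed

lemma arch_hom_converse:
  "arch_hom (fst A, (snd A)\<inverse>) B = arch_hom A B"
  "arch_hom B (fst A, (snd A)\<inverse>) = arch_hom B A"
  by (auto simp: arch_hom_def positive_map_def negative_map_def)


section \<open>The ring structure determined by an initial element\<close>

text \<open>
  An arrow from \<open>(A, i)\<close> to \<open>(A, x)\<close> is multiplication by the coordinate of \<open>x\<close>, hence its value
  at \<open>y\<close> has the product of the two coordinates as its coordinate.
\<close>

lemma coordinate_image_mult_closed:
  assumes A: "(A, i) \<in> Ob AG_pt_I" and x: "x \<in> carrier (fst A)" and y: "y \<in> carrier (fst A)"
  shows "coordinate A i x * coordinate A i y \<in> coordinate A i ` carrier (fst A)"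
proof (cases "x = \<one>\<^bsub>fst A\<^esub>")
  case True
  have "(A, i) \<in> Ob AG_pt" using A by (simp add: AG_pt_I_ob_iff)
  then show ?thesis using True x coordinate_one[of A i] by (auto intro!: image_eqI[of _ _ x])
next
  case False
  have A': "(A, i) \<in> Ob AG_pt" using A by (simp add: AG_pt_I_ob_iff)
  have "Hom AG_pt (A, i) (A, x) \<noteq> {}"
    using A x False by (auto simp: AG_pt_I_ob_iff initial_element_def)
  then obtain f where f: "f \<in> arch_hom A A" "f i = x" by (auto simp: AG_pt_hom)
  then have "coordinate A i (f y) = coordinate A i x * coordinate A i y"
    using arch_hom_coordinate[OF A' A' f(1) y] by simp
  moreover have "f y \<in> carrier (fst A)" using f y by (auto simp: arch_hom_def hom_in_carrier)
  ultimately show ?thesis by (metis imageI)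
qed

text \<open>
  The order is pulled back from \<open>\<real>\<close>, not copied from \<open>A\<close>: this makes \<open>i\<close> positive even if it is
  negative in \<open>A\<close>.
\<close>

fun coordinate_ring :: "'a ordered_grp \<times> 'a \<Rightarrow> 'a ordered_rng" where
  "coordinate_ring (A, i) =
    (\<lparr>carrier = carrier (fst A),
      mult = (\<lambda>x y. inv_into (carrier (fst A)) (coordinate A i)
        (coordinate A i x * coordinate A i y)),
      one = i, zero = \<one>\<^bsub>fst A\<^esub>, add = mult (fst A)\<rparr>,
     {(x, y). x \<in> carrier (fst A) \<and> y \<in> carrier (fst A) \<and>
       coordinate A i x < coordinate A i y})"

lemma coordinate_ring_order_cases:
  "(A, i) \<in> Ob AG_pt \<Longrightarrow>
    snd (coordinate_ring (A, i)) = snd A \<or> snd (coordinate_ring (A, i)) = (snd A)\<inverse>"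
  using coordinate_order_cases[of A i] by simp

lemma coordinate_ring_mult:
  assumes "(A, i) \<in> Ob AG_pt_I" "x \<in> carrier (fst A)" "y \<in> carrier (fst A)"
  defines "R \<equiv> fst (coordinate_ring (A, i))"
  shows "x \<otimes>\<^bsub>R\<^esub> y \<in> carrier (fst A)"
    and "coordinate A i (x \<otimes>\<^bsub>R\<^esub> y) = coordinate A i x * coordinate A i y"
  using coordinate_image_mult_closed[OF assms(1-3)]
  by (simp_all add: R_def inv_into_into f_inv_into_f)

text \<open>
  The ring axioms hold because the coordinate embeds the structure injectively into the field of real
  numbers.
\<close>

lemma coordinate_ring_ob:
  assumes A: "(A, i) \<in> Ob AG_pt_I"
  shows "coordinate_ring (A, i) \<in> Ob AR"
proof -
  have A': "(A, i) \<in> Ob AG_pt" using A by (simp add: AG_pt_I_ob_iff)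
  interpret A: archimedean_group "fst A" "snd A" using A' by (simp add: AG_pt_ob_iff)
  define R where "R = fst (coordinate_ring (A, i))"
  define \<phi> where "\<phi> = coordinate A i"
  have sel: "carrier R = carrier (fst A)" "\<one>\<^bsub>R\<^esub> = i" "\<zero>\<^bsub>R\<^esub> = \<one>\<^bsub>fst A\<^esub>"
    "(\<oplus>\<^bsub>R\<^esub>) = (\<otimes>\<^bsub>fst A\<^esub>)"
    by (simp_all add: R_def)
  have i: "i \<in> carrier (fst A)" "i \<noteq> \<one>\<^bsub>fst A\<^esub>" using A' by (auto simp: AG_pt_ob_iff)
  have inj: "x = y" if "\<phi> x = \<phi> y" "x \<in> carrier (fst A)" "y \<in> carrier (fst A)" for x y
    using inj_onD[OF inj_on_coordinate[OF A']] that by (simp add: \<phi>_def)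
  note \<phi> = coordinate_ring_mult[OF A, folded R_def \<phi>_def] coordinate_mult[OF A', folded \<phi>_def]
    coordinate_one[OF A', folded \<phi>_def] coordinate_unit[OF A', folded \<phi>_def]
  have "ring R"
  proof (rule ringI)
    show "abelian_group R"
    proof (rule abelian_groupI)
      fix x y assume "x \<in> carrier R" "y \<in> carrier R"
      then show "x \<oplus>\<^bsub>R\<^esub> y = y \<oplus>\<^bsub>R\<^esub> x" by (intro inj) (auto simp: sel \<phi>)
    next
      fix x assume "x \<in> carrier R"
      then show "\<exists>y \<in> carrier R. y \<oplus>\<^bsub>R\<^esub> x = \<zero>\<^bsub>R\<^esub>"
        by (intro bexI[of _ "inv\<^bsub>fst A\<^esub> x"]) (auto simp: sel)
    qed (auto simp: sel A.m_assoc)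
    show "monoid R"
      by (rule monoidI) (auto simp: sel \<phi> i intro!: inj)
  qed (auto simp: sel \<phi> algebra_simps intro!: inj)
  moreover have "archimedean_group (add_monoid R) (snd (coordinate_ring (A, i)))"
  proof -
    have "add_monoid R = fst A" by (simp add: R_def)
    then show ?thesis
      using coordinate_ring_order_cases[OF A'] A.reversed_archimedean_group
        A.archimedean_group_axioms by metis
  qed
  moreover have "(\<zero>\<^bsub>R\<^esub>, a \<otimes>\<^bsub>R\<^esub> b) \<in> snd (coordinate_ring (A, i))"
    if "(\<zero>\<^bsub>R\<^esub>, a) \<in> snd (coordinate_ring (A, i))"
      "(\<zero>\<^bsub>R\<^esub>, b) \<in> snd (coordinate_ring (A, i))" for a b
  proof -
    have "snd (coordinate_ring (A, i)) =
        {(x, y). x \<in> carrier (fst A) \<and> y \<in> carrier (fst A) \<and> \<phi> x < \<phi> y}"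
      by (simp add: \<phi>_def)
    with that show ?thesis by (simp add: sel \<phi> del: coordinate_ring.simps)
  qed
  ultimately have "archimedean_ring R (snd (coordinate_ring (A, i)))"
    using i by (auto simp: archimedean_ring_def archimedean_ring_axioms_def sel)
  then show ?thesis by (simp only: AR_ob_iff R_def)
qed


section \<open>Archimedean rings\<close>

context archimedean_ring
begin

sublocale additive: archimedean_group "add_monoid R" r
  rewrites "carrier (add_monoid R) = carrier R" and "mult (add_monoid R) = add R"
    and "one (add_monoid R) = zero R"
  by (rule additive_archimedean) simp_all

lemma less_iff_diff_pos:
  assumes "x \<in> carrier R" "y \<in> carrier R"
  shows "(x, y) \<in> r \<longleftrightarrow> (\<zero>, y \<ominus> x) \<in> r"
  using additive.less_translate_right[of x y "\<ominus> x"]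
    additive.less_translate_right[of \<zero> "y \<ominus> x" x] assms
  by (auto simp: r_neg l_neg a_assoc minus_eq)

lemma mult_right_strict_mono:
  assumes xy: "(x, y) \<in> r" and a: "(\<zero>, a) \<in> r"
  shows "(x \<otimes> a, y \<otimes> a) \<in> r"
proof -
  have c: "x \<in> carrier R" "y \<in> carrier R" "a \<in> carrier R"
    using xy a additive.less_carrier by auto
  have "(\<zero>, (y \<ominus> x) \<otimes> a) \<in> r"
    using mult_pos[OF _ a] xy less_iff_diff_pos c by blast
  moreover have "(y \<ominus> x) \<otimes> a = y \<otimes> a \<ominus> x \<otimes> a"
    using c by (simp add: minus_eq l_distr l_minus)
  ultimately show ?thesis using less_iff_diff_pos c by simp
qed

lemma mult_right_strict_antimono:
  assumes xy: "(x, y) \<in> r" and a: "(a, \<zero>) \<in> r"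
  shows "(y \<otimes> a, x \<otimes> a) \<in> r"
proof -
  have c: "x \<in> carrier R" "y \<in> carrier R" "a \<in> carrier R"
    using xy a additive.less_carrier by auto
  have "(\<zero>, \<ominus> a) \<in> r" using a less_iff_diff_pos[of a \<zero>] c by (simp add: minus_eq)
  from mult_right_strict_mono[OF xy this] have "(\<ominus> (x \<otimes> a), \<ominus> (y \<otimes> a)) \<in> r"
    using c by (simp add: r_minus)
  then show ?thesis
    using less_iff_diff_pos[of "\<ominus> (x \<otimes> a)" "\<ominus> (y \<otimes> a)"] less_iff_diff_pos[of "y \<otimes> a" "x \<otimes> a"] c
    by (simp add: minus_eq a_comm)
qed

end

lemma right_mult_arch_hom:
  assumes R: "R \<in> Ob AR" and a: "a \<in> carrier (fst R)" "a \<noteq> \<zero>\<^bsub>fst R\<^esub>"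
  shows "(\<lambda>x \<in> carrier (fst R). x \<otimes>\<^bsub>fst R\<^esub> a) \<in> arch_hom (underlying_group R) (underlying_group R)"
    (is "?f \<in> _")
proof -
  interpret archimedean_ring "fst R" "snd R" using R by (simp add: AR_ob_iff)
  have c: "(x, y) \<in> snd R \<Longrightarrow> x \<in> carrier (fst R) \<and> y \<in> carrier (fst R)" for x y
    using additive.less_carrier by auto
  have "positive_map (snd R) (snd R) ?f \<or> negative_map (snd R) (snd R) ?f"
    using additive.pos_cases[OF a]
  proof
    assume "(\<zero>\<^bsub>fst R\<^esub>, a) \<in> snd R"
    then show ?thesis using c mult_right_strict_mono by (simp add: positive_map_def)
  next
    assume "(\<zero>\<^bsub>fst R\<^esub>, a) \<in> (snd R)\<inverse>"
    then show ?thesis using c mult_right_strict_antimono by (simp add: negative_map_def)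
  qed
  then show ?thesis
    using a by (auto simp: arch_hom_def hom_def l_distr underlying_group_def)
qed

lemma carrier_underlying_group [simp]: "carrier (fst (underlying_group R)) = carrier (fst R)"
  by (simp add: underlying_group_def)

lemma Gamma_ob:
  assumes "R \<in> Ob AR"
  shows "(underlying_group R, \<one>\<^bsub>fst R\<^esub>) \<in> Ob AG_pt_I"
proof -
  interpret archimedean_ring "fst R" "snd R" using assms by (simp add: AR_ob_iff)
  have "(\<lambda>x \<in> carrier (fst R). x \<otimes>\<^bsub>fst R\<^esub> a)
      \<in> Hom AG_pt (underlying_group R, \<one>\<^bsub>fst R\<^esub>) (underlying_group R, a)"
    if "a \<in> carrier (fst R)" "a \<noteq> \<zero>\<^bsub>fst R\<^esub>" for a
    using right_mult_arch_hom[OF assms that] that by (simp add: AG_pt_hom underlying_group_def)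
  then show ?thesis
    using additive_archimedean one_neq_zero
    by (auto simp: AG_pt_I_ob_iff AG_pt_ob_iff initial_element_def underlying_group_def)
qed

lemma Gamma_ob_AG_pt: "R \<in> Ob AR \<Longrightarrow> (underlying_group R, \<one>\<^bsub>fst R\<^esub>) \<in> Ob AG_pt"
  using Gamma_ob[of R] by (simp only: AG_pt_I_ob_iff)

text \<open>
  Right multiplication by \<open>y\<close> is a morphism sending \<open>1\<close> to \<open>y\<close>, so it scales the coordinates by that
  of \<open>y\<close>.
\<close>

lemma ring_coordinate_mult:
  assumes R: "R \<in> Ob AR" and x: "x \<in> carrier (fst R)" and y: "y \<in> carrier (fst R)"
  defines "\<phi> \<equiv> coordinate (underlying_group R) \<one>\<^bsub>fst R\<^esub>"
  shows "\<phi> (x \<otimes>\<^bsub>fst R\<^esub> y) = \<phi> x * \<phi> y"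
proof -
  interpret archimedean_ring "fst R" "snd R" using R by (simp add: AR_ob_iff)
  show ?thesis
  proof (cases "y = \<zero>\<^bsub>fst R\<^esub>")
    case True
    then show ?thesis
      using coordinate_one[OF Gamma_ob_AG_pt[OF R]] x by (simp add: \<phi>_def underlying_group_def)
  next
    case False
    from arch_hom_coordinate[OF Gamma_ob_AG_pt[OF R] Gamma_ob_AG_pt[OF R]
        right_mult_arch_hom[OF R y False], of x]
    show ?thesis using x y by (simp add: \<phi>_def underlying_group_def)
  qed
qed

text \<open>
  A morphism preserving \<open>1\<close> preserves coordinates; these are multiplicative and injective.
\<close>

lemma unital_arch_hom_is_ring_hom:
  assumes R: "R \<in> Ob AR" and S: "S \<in> Ob AR"
    and f: "f \<in> arch_hom (underlying_group R) (underlying_group S)"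
    and f1: "f \<one>\<^bsub>fst R\<^esub> = \<one>\<^bsub>fst S\<^esub>"
  shows "f \<in> ring_hom (fst R) (fst S)"
proof -
  interpret R: archimedean_ring "fst R" "snd R" using R by (simp add: AR_ob_iff)
  interpret S: archimedean_ring "fst S" "snd S" using S by (simp add: AR_ob_iff)
  note ObR = Gamma_ob_AG_pt[OF R] and ObS = Gamma_ob_AG_pt[OF S]
  have fh: "f \<in> hom (add_monoid (fst R)) (add_monoid (fst S))"
    using f by (simp add: arch_hom_def underlying_group_def)
  have fc: "f x \<in> carrier (fst S)" if "x \<in> carrier (fst R)" for x
    using hom_in_carrier[OF fh] that by simp
  have \<phi>: "coordinate (underlying_group S) \<one>\<^bsub>fst S\<^esub> (f x) =
      coordinate (underlying_group R) \<one>\<^bsub>fst R\<^esub> x" if "x \<in> carrier (fst R)" for x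
    using arch_hom_coordinate[OF ObR ObS f, of x] that f1 ObS by (simp add: underlying_group_def)
  have "f (x \<otimes>\<^bsub>fst R\<^esub> y) = f x \<otimes>\<^bsub>fst S\<^esub> f y"
    if "x \<in> carrier (fst R)" "y \<in> carrier (fst R)" for x y
    by (rule inj_onD[OF inj_on_coordinate[OF ObS]])
      (use that fc in \<open>simp_all add: \<phi> ring_coordinate_mult[OF R] ring_coordinate_mult[OF S]\<close>)
  then show ?thesis
    using fh fc f1 hom_mult[OF fh] by (intro ring_hom_memI) auto
qed

lemma AR_hom_eq:
  assumes "R \<in> Ob AR" "S \<in> Ob AR"
  shows "Hom AR R S = Hom AG_pt_I (FOb Gamma R) (FOb Gamma S)"
  using unital_arch_hom_is_ring_hom[OF assms]
  by (auto simp: AR_def AG_pt_I_def full_subcategory_def AG_pt_def Gamma_def ring_hom_one)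


section \<open>The adjoint equivalence\<close>

lemma category_full_subcategory:
  assumes "category C"
  shows "category (full_subcategory C P)"
proof -
  interpret category C by (rule assms)
  show ?thesis
    by unfold_locales
      (auto simp: full_subcategory_def ident_hom comp_hom comp_ident_left comp_ident_right comp_assoc)
qed

lemma arch_hom_compose:
  assumes A: "archimedean_group (fst A) (snd A)" and f: "f \<in> arch_hom A B" and g: "g \<in> arch_hom B C"
  shows "compose (carrier (fst A)) g f \<in> arch_hom A C"
proof -
  interpret archimedean_group "fst A" "snd A" by (rule A)
  have c: "(x, y) \<in> snd A \<Longrightarrow> x \<in> carrier (fst A) \<and> y \<in> carrier (fst A)" for x y
    using less_carrier by auto
  have "compose (carrier (fst A)) g f \<in> hom (fst A) (fst C)"
    using f g by (intro hom_compose) (auto simp: arch_hom_def)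
  then show ?thesis
    using f g c
    unfolding arch_hom_def positive_map_def negative_map_def compose_def
    by (fastforce simp: compose_def)
qed

lemma category_AG_pt: "category AG_pt"
proof
  fix X assume "X \<in> Ob AG_pt"
  then obtain A a where X: "X = (A, a)" "archimedean_group (fst A) (snd A)" "a \<in> carrier (fst A)"
    by (cases X) (auto simp: AG_pt_ob_iff)
  interpret archimedean_group "fst A" "snd A" by (rule X)
  have "positive_map (snd A) (snd A) (\<lambda>x \<in> carrier (fst A). x)"
    using less_carrier by (auto simp: positive_map_def)
  then show "Ident AG_pt X \<in> Hom AG_pt X X"
    using X by (auto simp: AG_pt_def arch_hom_def hom_def)
next
  fix X Y Z f g
  assume "X \<in> Ob AG_pt" "Y \<in> Ob AG_pt" "Z \<in> Ob AG_pt" "f \<in> Hom AG_pt X Y" "g \<in> Hom AG_pt Y Z"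
  then show "Comp AG_pt X Y Z g f \<in> Hom AG_pt X Z"
    by (cases X; cases Y; cases Z) (auto simp: AG_pt_def compose_eq intro!: arch_hom_compose)
next
  fix X Y f assume "X \<in> Ob AG_pt" "Y \<in> Ob AG_pt" "f \<in> Hom AG_pt X Y"
  then obtain A a B b where XY: "X = (A, a)" "Y = (B, b)"
    and f: "f \<in> carrier (fst A) \<rightarrow> carrier (fst B)" "f \<in> extensional (carrier (fst A))"
    by (cases X; cases Y) (auto simp: AG_pt_def arch_hom_def hom_def)
  show "Comp AG_pt X X Y f (Ident AG_pt X) = f" "Comp AG_pt X Y Y (Ident AG_pt Y) f = f"
    using f by (auto simp: XY AG_pt_def compose_Id Id_compose)
next
  fix W X Y Z f g h
  assume "W \<in> Ob AG_pt" "X \<in> Ob AG_pt" "Y \<in> Ob AG_pt" "Z \<in> Ob AG_pt"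
    and "f \<in> Hom AG_pt W X" "g \<in> Hom AG_pt X Y" "h \<in> Hom AG_pt Y Z"
  then show "Comp AG_pt W X Z (Comp AG_pt X Y Z h g) f = Comp AG_pt W Y Z h (Comp AG_pt W X Y g f)"
    by (cases W; cases X; cases Y; cases Z)
      (auto simp: AG_pt_def arch_hom_def hom_def intro!: compose_assoc[symmetric])
qed

text \<open>
  Here the arrows of \<open>C\<close> are literally arrows of \<open>D\<close>, and \<open>\<Phi> (\<Psi> Y)\<close>, possibly different from \<open>Y\<close>,
  has the same incoming and outgoing arrows, identity and compositions as \<open>Y\<close>. The identities of \<open>D\<close>
  are then arrows \<open>Y \<rightarrow> \<Phi> (\<Psi> Y)\<close> and back, and every law to be checked is an identity law of \<open>D\<close>.
  For \<open>\<Gamma>\<close> the two objects differ by a reversal of the order.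
\<close>

lemma adjoint_equivalence_of_shared_arrows:
  fixes C :: "('o, 'm) cat" and D :: "('p, 'm) cat"
  assumes D: "category D"
    and \<Phi>: "\<And>X. X \<in> Ob C \<Longrightarrow> \<Phi> X \<in> Ob D" and \<Psi>: "\<And>Y. Y \<in> Ob D \<Longrightarrow> \<Psi> Y \<in> Ob C"
    and hom: "\<And>X Y. X \<in> Ob C \<Longrightarrow> Y \<in> Ob C \<Longrightarrow> Hom C X Y = Hom D (\<Phi> X) (\<Phi> Y)"
    and ident: "\<And>X. X \<in> Ob C \<Longrightarrow> Ident C X = Ident D (\<Phi> X)"
    and comp: "\<And>X Y Z. X \<in> Ob C \<Longrightarrow> Y \<in> Ob C \<Longrightarrow> Z \<in> Ob C \<Longrightarrow>
        Comp C X Y Z = Comp D (\<Phi> X) (\<Phi> Y) (\<Phi> Z)"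
    and hom': "\<And>Y Z. Y \<in> Ob D \<Longrightarrow> Z \<in> Ob D \<Longrightarrow> Hom D (\<Phi> (\<Psi> Y)) Z = Hom D Y Z"
      "\<And>Y Z. Y \<in> Ob D \<Longrightarrow> Z \<in> Ob D \<Longrightarrow> Hom D Z (\<Phi> (\<Psi> Y)) = Hom D Z Y"
    and ident': "\<And>Y. Y \<in> Ob D \<Longrightarrow> Ident D (\<Phi> (\<Psi> Y)) = Ident D Y"
    and comp': "\<And>X Y Z. X \<in> Ob D \<Longrightarrow> Comp D (\<Phi> (\<Psi> X)) Y Z = Comp D X Y Z"
      "\<And>X Y Z. Y \<in> Ob D \<Longrightarrow> Comp D X (\<Phi> (\<Psi> Y)) Z = Comp D X Y Z"
      "\<And>X Y Z. Z \<in> Ob D \<Longrightarrow> Comp D X Y (\<Phi> (\<Psi> Z)) = Comp D X Y Z"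
  shows "adjoint_equivalence C D \<lparr>FOb = \<Phi>, FArr = (\<lambda>X Y f. f)\<rparr> \<lparr>FOb = \<Psi>, FArr = (\<lambda>X Y f. f)\<rparr>
    (Ident C) (Ident D)"
proof -
  interpret D: category D by (rule D)
  note rules = \<Phi> \<Psi> hom ident comp hom' ident' comp' D.ident_hom D.comp_hom D.comp_ident_left
    D.comp_ident_right
  interpret C: category C
    by unfold_locales (simp_all add: rules D.comp_assoc)
  show ?thesis
    by unfold_locales
      (auto simp: rules id_fnctr_def comp_fnctr_def isomorphism_def
        intro!: bexI[of _ "Ident C _"] bexI[of _ "Ident D _"])
qed

theorem proposition5p5:
  shows "\<exists>\<Delta> \<eta> \<epsilon>.
    adjoint_equivalence (AR :: ('a ordered_rng, 'a \<Rightarrow> 'a) cat) AG_pt_I Gamma \<Delta> \<eta> \<epsilon>"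
proof -
  have full: "Hom AG_pt_I = Hom AG_pt" "Ident AG_pt_I = Ident AG_pt" "Comp AG_pt_I = Comp AG_pt"
    by (simp_all add: AG_pt_I_def full_subcategory_def)
  have Gamma: "Gamma = \<lparr>FOb = FOb Gamma, FArr = (\<lambda>R S f. f)\<rparr>" by (simp add: Gamma_def)
  have round_trip: "FOb Gamma (coordinate_ring (A, i)) = ((fst A, snd (coordinate_ring (A, i))), i)"
    for A :: "'a ordered_grp" and i
    by (simp add: Gamma_def underlying_group_def)
  have arrows: "arch_hom (fst A, snd (coordinate_ring (A, i))) B = arch_hom A B"
    "arch_hom B (fst A, snd (coordinate_ring (A, i))) = arch_hom B A"
    if "(A, i) \<in> Ob AG_pt_I" for A B :: "'a ordered_grp" and i
    using coordinate_ring_order_cases[of A i] that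
      arch_hom_converse[where A = A and B = B]
    by (auto simp: AG_pt_I_ob_iff simp del: coordinate_ring.simps)
  have "adjoint_equivalence (AR :: ('a ordered_rng, 'a \<Rightarrow> 'a) cat) AG_pt_I
      \<lparr>FOb = FOb Gamma, FArr = (\<lambda>R S f. f)\<rparr> \<lparr>FOb = coordinate_ring, FArr = (\<lambda>Y Z f. f)\<rparr>
      (Ident AR) (Ident AG_pt_I)"
  proof (rule adjoint_equivalence_of_shared_arrows)
    show "category AG_pt_I"
      unfolding AG_pt_I_def by (rule category_full_subcategory[OF category_AG_pt])
  next
    fix R :: "'a ordered_rng" assume "R \<in> Ob AR"
    then show "FOb Gamma R \<in> Ob AG_pt_I" using Gamma_ob by (simp add: Gamma_def)
  next
    fix Y :: "'a ordered_grp \<times> 'a" assume "Y \<in> Ob AG_pt_I"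
    then show "coordinate_ring Y \<in> Ob AR" using coordinate_ring_ob by (cases Y) (simp only:)
  next
    fix Y Z :: "'a ordered_grp \<times> 'a" assume YZ: "Y \<in> Ob AG_pt_I" "Z \<in> Ob AG_pt_I"
    obtain A i B j where [simp]: "Y = (A, i)" "Z = (B, j)" by (cases Y; cases Z)
    show "Hom AG_pt_I (FOb Gamma (coordinate_ring Y)) Z = Hom AG_pt_I Y Z"
      "Hom AG_pt_I Z (FOb Gamma (coordinate_ring Y)) = Hom AG_pt_I Z Y"
      using YZ arrows
      by (simp_all add: full round_trip AG_pt_hom del: coordinate_ring.simps)
  next
    fix Y X Z :: "'a ordered_grp \<times> 'a"
    obtain A i B j where [simp]: "Y = (A, i)" "X = (B, j)" by (cases Y; cases X)
    show "Ident AG_pt_I (FOb Gamma (coordinate_ring Y)) = Ident AG_pt_I Y"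
      "Comp AG_pt_I (FOb Gamma (coordinate_ring Y)) X Z = Comp AG_pt_I Y X Z"
      "Comp AG_pt_I X (FOb Gamma (coordinate_ring Y)) Z = Comp AG_pt_I X Y Z"
      "Comp AG_pt_I X Z (FOb Gamma (coordinate_ring Y)) = Comp AG_pt_I X Z Y"
      by (simp_all add: full round_trip AG_pt_def del: coordinate_ring.simps)
  next
    fix R S T :: "'a ordered_rng"
    show "Ident AR R = Ident AG_pt_I (FOb Gamma R)"
      "Comp AR R S T = Comp AG_pt_I (FOb Gamma R) (FOb Gamma S) (FOb Gamma T)"
      by (simp_all add: full AR_def AG_pt_def Gamma_def underlying_group_def)
  qed (rule AR_hom_eq)
  then show ?thesis unfolding Gamma[symmetric] by blast
qed

end
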